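(* Let $U$ be a set, $E$ a finite set, and $G=(F,E)$ a covering soft set over $U$, with associated soft covering approximation space $S=(U,C_G)$. Suppose that $G$ is a partition soft set, i.e. $C_G=\{F(e):e\in E\}$ is a partition of $U$. Equip $U$ with the topology generated by $C_G$ as a subbase, with closure $\operatorname{cl}$ and interior $\operatorname{int}$. Then for every $X\subseteq U$, $S^-(X)=\operatorname{cl}(X)$ and $S_-(X)=\operatorname{int}(X)$.
   Context: A soft set over $U$ is a pair $G=(F,E)$ with $F:E\to P(U)$ a map into the power set of $U$. It is a covering soft set if $\bigcup_{e\in E}F(e)=U$ and $F(e)\neq\emptyset$ for every $e\in E$. Write $C_G=\{F(e):e\in E\}$ (as a set of subsets of $U$); the pair $S=(U,C_G)$ is called a soft covering approximation space. For $x\in U$ the soft minimal description of $x$ is $Md_S(x)=\{F(e): e\in E,\ x\in F(e),\text{ and for all } a\in E,\ x\in F(a)\subseteq F(e)\text{ implies }F(a)=F(e)\}$. For $X\subseteq U$ the soft covering lower approximation is $S_-(X)=\bigcup\{F(e): e\in E,\ F(e)\subseteq X\}$ and the soft covering upper approximation is $S^-(X)=S_-(X)\cup\bigcup_{x\in X\setminus S_-(X)}\ \bigcup_{K\in Md_S(x)}K$. *)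

theory Defs
  imports "HOL-Analysis.Analysis" "HOL-Library.Disjoint_Sets"
begin

text \<open>
  A soft set \<open>(F, E)\<close> over \<open>U\<close> is rendered by two curried arguments \<open>F\<close> and \<open>E\<close>; all notions
  below depend only on the values of the total HOL function \<open>F\<close> on \<open>E\<close>.
\<close>

definition soft_set :: "'a set \<Rightarrow> ('e \<Rightarrow> 'a set) \<Rightarrow> 'e set \<Rightarrow> bool" where
  "soft_set U F E \<longleftrightarrow> F \<in> E \<rightarrow> Pow U"

definition covering_soft_set :: "'a set \<Rightarrow> ('e \<Rightarrow> 'a set) \<Rightarrow> 'e set \<Rightarrow> bool" where
  "covering_soft_set U F E \<longleftrightarrow> soft_set U F E \<and> (\<Union>e\<in>E. F e) = U \<and> (\<forall>e\<in>E. F e \<noteq> {})"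

definition soft_cover :: "('e \<Rightarrow> 'a set) \<Rightarrow> 'e set \<Rightarrow> 'a set set" where
  "soft_cover F E = {F e | e. e \<in> E}"

definition partition_soft_set :: "'a set \<Rightarrow> ('e \<Rightarrow> 'a set) \<Rightarrow> 'e set \<Rightarrow> bool" where
  "partition_soft_set U F E \<longleftrightarrow> soft_set U F E \<and> partition_on U (soft_cover F E)"

definition soft_min_desc :: "('e \<Rightarrow> 'a set) \<Rightarrow> 'e set \<Rightarrow> 'a \<Rightarrow> 'a set set" where
  "soft_min_desc F E x =
     {F e | e. e \<in> E \<and> x \<in> F e \<and> (\<forall>a\<in>E. x \<in> F a \<and> F a \<subseteq> F e \<longrightarrow> F a = F e)}"

definition soft_lower :: "('e \<Rightarrow> 'a set) \<Rightarrow> 'e set \<Rightarrow> 'a set \<Rightarrow> 'a set" where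
  "soft_lower F E X = \<Union>{F e | e. e \<in> E \<and> F e \<subseteq> X}"

definition soft_upper :: "('e \<Rightarrow> 'a set) \<Rightarrow> 'e set \<Rightarrow> 'a set \<Rightarrow> 'a set" where
  "soft_upper F E X =
     soft_lower F E X \<union> (\<Union>x \<in> X - soft_lower F E X. \<Union>K \<in> soft_min_desc F E x. K)"

text \<open>
  The library's \<open>topology_generated_by\<close> treats its argument as a subbase, but only closes it under
  binary intersections, so the underlying space is the union of the subbase.  For a covering soft
  set this union is \<open>U\<close>, hence this is the usual topology on \<open>U\<close>.
\<close>

definition soft_topology :: "('e \<Rightarrow> 'a set) \<Rightarrow> 'e set \<Rightarrow> 'a topology" where
  "soft_topology F E = topology_generated_by (soft_cover F E)"

end

theory Submission
  imports Defs
begin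

text \<open>
  In the topology generated by a partition, the open sets are the unions of blocks.  Hence the
  interior of \<open>X\<close> is the union of the blocks contained in \<open>X\<close> and its closure is the union of the
  blocks meeting \<open>X\<close>.  The only minimal description of a point is its block, so the upper
  approximation collects the blocks meeting \<open>X\<close>, too.
\<close>

lemma partition_on_same_block:
  assumes "partition_on U P" "B \<in> P" "C \<in> P" "x \<in> B" "x \<in> C"
  shows "B = C"
  using disjointD[OF partition_onD2[OF assms(1)] assms(2,3)] assms(4,5) by blast

text \<open>Openness is phrased as saturation, not as being a union of blocks, because saturation
  visibly survives the intersections and unions by which \<open>generate_topology_on\<close> builds
  open sets. Only the case of a single block uses disjointness.\<close>

lemma openin_topology_generated_by_partition_iff:
  assumes P: "partition_on U P"
  shows "openin (topology_generated_by P) S \<longleftrightarrow> S \<subseteq> U \<and> (\<forall>B\<in>P. B \<inter> S \<noteq> {} \<longrightarrow> B \<subseteq> S)"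
proof
  assume "openin (topology_generated_by P) S"
  then have "generate_topology_on P S"
    by (simp add: openin_topology_generated_by_iff)
  then show "S \<subseteq> U \<and> (\<forall>B\<in>P. B \<inter> S \<noteq> {} \<longrightarrow> B \<subseteq> S)"
  proof induction
    case Empty
    show ?case by simp
  next
    case (Int S T)
    then show ?case by blast
  next
    case (UN K)
    then show ?case by blast
  next
    case (Basis S)
    have "B \<subseteq> S" if "B \<in> P" "B \<inter> S \<noteq> {}" for B
      using partition_on_same_block[OF P \<open>B \<in> P\<close> Basis] that by auto
    moreover have "S \<subseteq> U"
      using partition_onD1[OF P] Basis by auto
    ultimately show ?case by simp
  qed
next
  assume S: "S \<subseteq> U \<and> (\<forall>B\<in>P. B \<inter> S \<noteq> {} \<longrightarrow> B \<subseteq> S)"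
  \<comment> \<open>Each point of \<open>S\<close> lies in some block since \<open>P\<close> covers
    \<open>U\<close>; that block meets \<open>S\<close>, so saturation puts it inside
    \<open>S\<close>.\<close>
  then have "S = \<Union>{B\<in>P. B \<subseteq> S}"
    using partition_onD1[OF P] by blast
  moreover have "openin (topology_generated_by P) (\<Union>{B\<in>P. B \<subseteq> S})"
    by (blast intro: topology_generated_by_Basis)
  ultimately show "openin (topology_generated_by P) S"
    by simp
qed

lemma interior_of_topology_generated_by_partition:
  assumes P: "partition_on U P"
  shows "topology_generated_by P interior_of X = \<Union>{B\<in>P. B \<subseteq> X}"
proof
  show "topology_generated_by P interior_of X \<subseteq> \<Union>{B\<in>P. B \<subseteq> X}"
  proof
    fix x assume "x \<in> topology_generated_by P interior_of X"
    then obtain T where T: "T \<subseteq> U" "\<forall>B\<in>P. B \<inter> T \<noteq> {} \<longrightarrow> B \<subseteq> T" "x \<in> T" "T \<subseteq> X"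
      unfolding interior_of_def openin_topology_generated_by_partition_iff[OF P] by blast
    \<comment> \<open>The block of \<open>x\<close> meets the open set \<open>T\<close>, so it lies
      in \<open>T\<close> and hence in \<open>X\<close>.\<close>
    then obtain B where "B \<in> P" "x \<in> B"
      using partition_onD1[OF P] by blast
    with T show "x \<in> \<Union>{B\<in>P. B \<subseteq> X}"
      by blast
  qed
  show "\<Union>{B\<in>P. B \<subseteq> X} \<subseteq> topology_generated_by P interior_of X"
  proof (rule interior_of_maximal)
    show "openin (topology_generated_by P) (\<Union>{B\<in>P. B \<subseteq> X})"
      by (blast intro: topology_generated_by_Basis)
  qed blast
qed

text \<open>A block is an open neighbourhood of each of its points, so the block of a closure point
  meets \<open>X\<close>. Conversely, every open set around \<open>x\<close> contains the whole
  block of \<open>x\<close>, and with it any point of \<open>X\<close> in that block.\<close>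

lemma closure_of_topology_generated_by_partition:
  assumes P: "partition_on U P"
  shows "topology_generated_by P closure_of X = \<Union>{B\<in>P. B \<inter> X \<noteq> {}}"
proof
  show "topology_generated_by P closure_of X \<subseteq> \<Union>{B\<in>P. B \<inter> X \<noteq> {}}"
  proof
    fix x assume x: "x \<in> topology_generated_by P closure_of X"
    then obtain B where "B \<in> P" "x \<in> B"
      by (auto simp: in_closure_of topology_generated_by_topspace)
    moreover from this x have "B \<inter> X \<noteq> {}"
      using topology_generated_by_Basis[of B P] by (auto simp: in_closure_of)
    ultimately show "x \<in> \<Union>{B\<in>P. B \<inter> X \<noteq> {}}"
      by blast
  qed
  show "\<Union>{B\<in>P. B \<inter> X \<noteq> {}} \<subseteq> topology_generated_by P closure_of X"
    unfolding closure_of_def openin_topology_generated_by_partition_iff[OF P]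
    by (simp only: topology_generated_by_topspace) blast
qed

lemma soft_lower_eq: "soft_lower F E X = \<Union>{B \<in> soft_cover F E. B \<subseteq> X}"
  by (auto simp: soft_lower_def soft_cover_def)

text \<open>Blocks that share \<open>x\<close> coincide, so the minimality condition holds
  automatically. For \<open>x\<close> outside \<open>U\<close> both sides are empty.\<close>

lemma soft_min_desc_partition:
  assumes "partition_on U (soft_cover F E)"
  shows "soft_min_desc F E x = {B \<in> soft_cover F E. x \<in> B}"
proof -
  have "F a = F e" if "a \<in> E" "e \<in> E" "x \<in> F a" "x \<in> F e" for a e
    using partition_on_same_block[OF assms, of "F a" "F e" x] that
    by (auto simp: soft_cover_def)
  then show ?thesis
    unfolding soft_min_desc_def soft_cover_def by blast
qed

lemma soft_upper_partition:
  assumes P: "partition_on U (soft_cover F E)"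
  shows "soft_upper F E X = \<Union>{B \<in> soft_cover F E. B \<inter> X \<noteq> {}}"
    (is "_ = ?R")
proof
  \<comment> \<open>Nonemptiness ensures that a block contained in \<open>X\<close> also meets
    \<open>X\<close>.\<close>
  have "B \<noteq> {}" if "B \<in> soft_cover F E" for B
    using partition_onD3[OF P] that by blast
  then have "soft_lower F E X \<subseteq> ?R"
    unfolding soft_lower_eq by blast
  then show "soft_upper F E X \<subseteq> ?R"
    unfolding soft_upper_def soft_min_desc_partition[OF P] by blast
  show "?R \<subseteq> soft_upper F E X"
  proof
    fix y assume "y \<in> ?R"
    then obtain B x where B: "B \<in> soft_cover F E" "y \<in> B" "x \<in> B" "x \<in> X"
      by blast
    show "y \<in> soft_upper F E X"
    \<comment> \<open>Minimal descriptions are collected only at points of \<open>X\<close> outside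
      the lower approximation. If \<open>x\<close> is inside it, \<open>B\<close> itself is
      contained in \<open>X\<close> and \<open>y\<close> already belongs to the lower
      approximation.\<close>
    proof (cases "x \<in> soft_lower F E X")
      case True
      then obtain C where C: "C \<in> soft_cover F E" "C \<subseteq> X" "x \<in> C"
        unfolding soft_lower_eq by blast
      then have "C = B"
        using partition_on_same_block[OF P] B by metis
      then show ?thesis
        using B C unfolding soft_upper_def soft_lower_eq by blast
    next
      case False
      then show ?thesis
        using B unfolding soft_upper_def soft_min_desc_partition[OF P] by blast
    qed
  qed
qed

theorem theorem34:
  fixes U :: "'a set" and E :: "'e set" and F :: "'e \<Rightarrow> 'a set"
  assumes "finite E"
    and "covering_soft_set U F E"
    and "partition_soft_set U F E"
  shows "\<forall>X. X \<subseteq> U \<longrightarrow>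
           soft_upper F E X = soft_topology F E closure_of X \<and>
           soft_lower F E X = soft_topology F E interior_of X"
proof -
  have P: "partition_on U (soft_cover F E)"
    using assms(3) by (simp add: partition_soft_set_def)
  show ?thesis
    unfolding soft_topology_def soft_lower_eq
      closure_of_topology_generated_by_partition[OF P]
      interior_of_topology_generated_by_partition[OF P]
    using soft_upper_partition[OF P] by simp
qed

end
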